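(* Let $S=S[1]\cdots S[d]$ be a string (the current window) having at least one nonempty implicit suffix, let $S[a..d]$ be the longest implicit suffix of $S$, let $L$ be the initial position of a suffix leaf lying below the locus of $S[a..d]$ in the suffix tree of $S$ (so that $L<a$), and put $\pi=a-L$. For every implicit suffix $S[i..d]$ define $$\rho(i)=L+\bigl((i-a)\bmod \pi\bigr).$$ Then for every implicit suffix $S[i..d]$, the string $S[i..d]$ is a prefix of $S[\rho(i)..d]$.
   Context: $S[i..j]$ denotes $S[i]\cdots S[j]$, and $S[i..d]$ is the suffix with initial position $i$. The suffix tree of $S$ is the compacted trie of all suffixes of $S$, built without appending a unique terminal symbol. A suffix is leaf-represented if it corresponds to a leaf of this tree; otherwise it is implicit (equivalently, it is a proper prefix of another suffix), and its locus is then an explicit internal node or a point in the middle of an edge. The locus of a string is the (explicit or implicit) point of the tree whose path label from the root is that string. The implicit suffixes are exactly the suffixes of $S[a..d]$, i.e. $S[i..d]$ is leaf-represented if $i<a$ and implicit if $i\ge a$. A leaf has initial position $L$ if its path label is $S[L..d]$. *)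

theory Defs
  imports "HOL-Library.Sublist"
begin

record ('v, 'a) ltree =
  root :: 'v
  verts :: "'v set"
  edges :: "('v \<times> 'a list \<times> 'v) set"

inductive path :: "('v, 'a) ltree \<Rightarrow> 'v \<Rightarrow> 'a list \<Rightarrow> 'v \<Rightarrow> bool" for T where
  refl: "u \<in> verts T \<Longrightarrow> path T u [] u"
| step: "path T u w v \<Longrightarrow> (v, l, x) \<in> edges T \<Longrightarrow> path T u (w @ l) x"

definition leaf :: "('v, 'a) ltree \<Rightarrow> 'v \<Rightarrow> bool" where
  "leaf T v \<longleftrightarrow> v \<in> verts T \<and> (\<nexists>l x. (v, l, x) \<in> edges T)"

text \<open>A point of the tree is a vertex (an explicit point) or lies in the middle of an edge
  (an implicit point), \<open>k\<close> letters below the upper end of the edge.\<close>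

datatype ('v, 'a) point = Vertex 'v | Mid 'v "'a list" 'v nat

inductive path_label :: "('v, 'a) ltree \<Rightarrow> ('v, 'a) point \<Rightarrow> 'a list \<Rightarrow> bool" for T where
  vertex: "path T (root T) w v \<Longrightarrow> path_label T (Vertex v) w"
| mid: "path T (root T) w u \<Longrightarrow> (u, l, v) \<in> edges T \<Longrightarrow> 0 < k \<Longrightarrow> k < length l \<Longrightarrow>
    path_label T (Mid u l v k) (w @ take k l)"

text \<open>The description is unique in the compacted trie of a finite set of words, for every \<open>w\<close> that is
  a prefix of one of the words.\<close>

definition locus :: "('v, 'a) ltree \<Rightarrow> 'a list \<Rightarrow> ('v, 'a) point" where
  "locus T w = (THE p. path_label T p w)"

text \<open>A vertex counts as lying below itself; the first vertex below a point in the middle of an edge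
  is the lower end of that edge.\<close>

fun below :: "('v, 'a) ltree \<Rightarrow> 'v \<Rightarrow> ('v, 'a) point \<Rightarrow> bool" where
  "below T x (Vertex u) \<longleftrightarrow> (\<exists>w. path T u w x)"
| "below T x (Mid u l v k) \<longleftrightarrow> (\<exists>w. path T v w x)"

text \<open>In the uncompacted trie of a set of words, the nodes are the prefixes of the words, the root
  is the empty word, and there is an edge from \<open>u\<close> to \<open>u @ [c]\<close> whenever both are nodes.\<close>

definition trie :: "'a list set \<Rightarrow> 'a list set" where
  "trie W = {u. \<exists>w\<in>W. prefix u w}"

definition trie_leaf :: "'a list set \<Rightarrow> 'a list \<Rightarrow> bool" where
  "trie_leaf W u \<longleftrightarrow> u \<in> trie W \<and> (\<nexists>c. u @ [c] \<in> trie W)"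

definition trie_branching :: "'a list set \<Rightarrow> 'a list \<Rightarrow> bool" where
  "trie_branching W u \<longleftrightarrow> (\<exists>c c'. c \<noteq> c' \<and> u @ [c] \<in> trie W \<and> u @ [c'] \<in> trie W)"

text \<open>Compaction keeps the root, the leaves and the branching nodes, and contracts each maximal
  chain of other nodes into one edge. Words of \<open>W\<close> ending at a contracted node, or at a branching
  one, leave no mark in the tree: there is no terminal symbol.\<close>

definition explicit_nodes :: "'a list set \<Rightarrow> 'a list set" where
  "explicit_nodes W = {u \<in> trie W. u = [] \<or> trie_leaf W u \<or> trie_branching W u}"

definition compacted_trie :: "'a list set \<Rightarrow> ('a list, 'a) ltree" where
  "compacted_trie W = \<lparr>
     root = [],
     verts = explicit_nodes W,
     edges = {(u, l, v). u \<in> explicit_nodes W \<and> v \<in> explicit_nodes W \<and> v = u @ l \<and> l \<noteq> [] \<and>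
       (\<forall>k. 0 < k \<longrightarrow> k < length l \<longrightarrow> u @ take k l \<notin> explicit_nodes W)}\<rparr>"

definition suffix_tree :: "'a list \<Rightarrow> ('a list, 'a) ltree" where
  "suffix_tree S = compacted_trie (set (suffixes S))"

text \<open>Positions are counted from 1, so \<open>suffix_at S i\<close> is $S[i..d]$ for $d$ the length of \<open>S\<close>.
  The position $d + 1$ stands for the empty suffix.\<close>

definition suffix_at :: "'a list \<Rightarrow> nat \<Rightarrow> 'a list" where
  "suffix_at S i = drop (i - 1) S"

definition positions :: "'a list \<Rightarrow> nat set" where
  "positions S = {1..length S + 1}"

definition leaf_position :: "'a list \<Rightarrow> 'a list \<Rightarrow> nat \<Rightarrow> bool" where
  "leaf_position S v L \<longleftrightarrow> leaf (suffix_tree S) v \<and> L \<in> positions S \<and>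
     path_label (suffix_tree S) (Vertex v) (suffix_at S L)"

definition leaf_represented :: "'a list \<Rightarrow> nat \<Rightarrow> bool" where
  "leaf_represented S i \<longleftrightarrow> (\<exists>v. leaf_position S v i)"

definition implicit_suffix :: "'a list \<Rightarrow> nat \<Rightarrow> bool" where
  "implicit_suffix S i \<longleftrightarrow> i \<in> positions S \<and> \<not> leaf_represented S i"

definition longest_implicit_suffix :: "'a list \<Rightarrow> nat \<Rightarrow> bool" where
  "longest_implicit_suffix S a \<longleftrightarrow> implicit_suffix S a \<and>
     (\<forall>i. implicit_suffix S i \<longrightarrow> length (suffix_at S i) \<le> length (suffix_at S a))"

text \<open>Computed on the integers, so that no subtraction is truncated.\<close>

definition rho :: "nat \<Rightarrow> nat \<Rightarrow> nat \<Rightarrow> nat" where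
  "rho a L i = nat (int L + (int i - int a) mod (int a - int L))"

end

theory Submission
  imports Defs
begin

text \<open>If the locus of $S[a..d]$ lies above the leaf labelled $S[L..d]$, then $S[a..d]$ is a
  prefix of $S[L..d]$, so $\pi = a - L$ is a period of $S[L..d]$. As $i - \rho(i)$ is a multiple
  of $\pi$, shifting by it inside $S[L..d]$ yields the claim. The tree enters only through the fact
  that the locus, a definite description, denotes: existence needs that the set of words is
  finite, and uniqueness that branching nodes are explicit.\<close>

subsection \<open>Loci in compacted tries\<close>

lemma compacted_trie_simps [simp]:
  "root (compacted_trie W) = []"
  "verts (compacted_trie W) = explicit_nodes W"
  by (simp_all add: compacted_trie_def)

text \<open>The words \<open>u @ take k l\<close> with \<open>0 < k\<close> and
  \<open>k < length l\<close> are exactly those strictly between \<open>u\<close> and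
  \<open>u @ l\<close> in the prefix order. This form frees later arguments from indices.\<close>

lemma edges_compacted_trie_iff:
  "(u, l, v) \<in> edges (compacted_trie W) \<longleftrightarrow>
    u \<in> explicit_nodes W \<and> v \<in> explicit_nodes W \<and> v = u @ l \<and> l \<noteq> [] \<and>
    (\<forall>x\<in>explicit_nodes W. strict_prefix u x \<longrightarrow> \<not> strict_prefix x v)"
proof (cases "v = u @ l")
  case True
  have "(\<forall>k. 0 < k \<longrightarrow> k < length l \<longrightarrow> u @ take k l \<notin> explicit_nodes W) \<longleftrightarrow>
    (\<forall>x\<in>explicit_nodes W. strict_prefix u x \<longrightarrow> \<not> strict_prefix x (u @ l))"
  proof (intro iffI ballI impI notI allI)
    fix x
    assume gap: "\<forall>k. 0 < k \<longrightarrow> k < length l \<longrightarrow> u @ take k l \<notin> explicit_nodes W"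
      and x: "x \<in> explicit_nodes W" "strict_prefix u x" "strict_prefix x (u @ l)"
    obtain y where y: "x = u @ y" "y \<noteq> []"
      using x(2) by (blast elim: strict_prefixE')
    then obtain z where z: "l = y @ z" "z \<noteq> []"
      using x(3) by (auto simp: strict_prefix_def prefix_def)
    show False
      using gap[rule_format, of "length y"] x(1) y z by simp
  next
    fix k
    assume gap: "\<forall>x\<in>explicit_nodes W. strict_prefix u x \<longrightarrow> \<not> strict_prefix x (u @ l)"
      and k: "0 < k" "k < length l" "u @ take k l \<in> explicit_nodes W"
    have "strict_prefix u (u @ take k l)"
      using k(1,2) by (auto simp: strict_prefix_def)
    moreover have "strict_prefix (u @ take k l) (u @ l)"
      using k(2) by (auto simp: strict_prefix_def take_is_prefix)
    ultimately show False
      using gap k(3) by blast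
  qed
  with True show ?thesis
    by (auto simp: compacted_trie_def)
qed (auto simp: compacted_trie_def)

lemma path_compacted_trieD: "path (compacted_trie W) u w x \<Longrightarrow> x = u @ w"
  by (induction rule: path.induct) (auto simp: edges_compacted_trie_iff)

lemma path_compacted_trie_verts: "path (compacted_trie W) u w x \<Longrightarrow> x \<in> explicit_nodes W"
  by (induction rule: path.induct) (auto simp: edges_compacted_trie_iff)

section \<open>Explicit nodes around a given trie node\<close>

lemma trie_prefix_closed: "prefix u w \<Longrightarrow> w \<in> trie W \<Longrightarrow> u \<in> trie W"
  unfolding trie_def by (blast intro: prefix_order.trans)

lemma finite_trie:
  assumes "finite W"
  shows "finite (trie W)"
proof -
  have "trie W = (\<Union>w\<in>W. set (prefixes w))"
    by (auto simp: trie_def)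
  with assms show ?thesis
    by simp
qed

lemma explicit_nodes_trie: "u \<in> explicit_nodes W \<Longrightarrow> u \<in> trie W"
  by (simp add: explicit_nodes_def)

lemma Nil_explicit: "w \<in> trie W \<Longrightarrow> [] \<in> explicit_nodes W"
  by (auto simp: explicit_nodes_def intro: trie_prefix_closed)

lemma ex_explicit_extension:
  assumes "finite W" "w \<in> trie W"
  shows "\<exists>v\<in>explicit_nodes W. prefix w v"
proof -
  define E where "E = {v \<in> trie W. prefix w v}"
  have "finite E" "w \<in> E"
    using assms by (auto simp: E_def finite_trie)
  then obtain v where v: "v \<in> E" and max: "\<And>x. x \<in> E \<Longrightarrow> length x \<le> length v"
    using Max_in[of "length ` E"] Max_ge[of "length ` E"]
    by (metis (no_types, lifting) empty_iff finite_imageI image_iff)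
  \<comment> \<open>A child \<open>v @ [c]\<close> in the trie would be a longer member of
    \<open>E\<close>.\<close>
  have "trie_leaf W v"
    unfolding trie_leaf_def
    using v max[of "v @ [_]"] by (auto simp: E_def)
  with v show ?thesis
    by (auto simp: E_def explicit_nodes_def)
qed

text \<open>The empty word is a candidate, and the prefixes of \<open>w\<close> form a chain, so the
  longest candidate has all others as prefixes. It serves as the upper end of an edge into or
  through \<open>w\<close>.\<close>

lemma ex_longest_explicit_prefix:
  assumes "w \<in> trie W" "w \<noteq> []"
  obtains u where "u \<in> explicit_nodes W" "strict_prefix u w"
    "\<And>x. x \<in> explicit_nodes W \<Longrightarrow> strict_prefix x w \<Longrightarrow> prefix x u"
proof -
  let ?P = "\<lambda>u. u \<in> explicit_nodes W \<and> strict_prefix u w"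
  have "?P []"
    using assms(2) Nil_explicit[OF assms(1)] by (simp add: strict_prefix_def)
  moreover have "\<forall>u. ?P u \<longrightarrow> length u < length w"
    by (auto dest: prefix_length_less)
  ultimately have "\<exists>u. ?P u \<and> (\<forall>x. ?P x \<longrightarrow> length x \<le> length u)"
    by (rule ex_has_greatest_nat)
  then obtain u where u: "?P u" and max: "\<And>x. ?P x \<Longrightarrow> length x \<le> length u"
    by blast
  have "prefix x u" if "?P x" for x
    using that u max[OF that] by (meson prefix_length_prefix strict_prefix_def)
  with u show ?thesis
    by (intro that[of u]) simp_all
qed

text \<open>No explicit node lies strictly between \<open>w\<close> and its longest explicit strict
  prefix, so a single edge extends the path given by induction on the length.\<close>

lemma path_to_explicit_node:
  "w \<in> explicit_nodes W \<Longrightarrow> path (compacted_trie W) [] w w"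
proof (induction w rule: length_induct)
  case (1 w)
  show ?case
  proof (cases "w = []")
    case True
    with 1 show ?thesis
      by (auto intro: path.refl)
  next
    case False
    then obtain u where u: "u \<in> explicit_nodes W" "strict_prefix u w"
      and max: "\<And>x. x \<in> explicit_nodes W \<Longrightarrow> strict_prefix x w \<Longrightarrow> prefix x u"
      using ex_longest_explicit_prefix[of w W] explicit_nodes_trie 1(2) by metis
    obtain l where l: "w = u @ l" "l \<noteq> []"
      using u(2) by (blast elim: strict_prefixE')
    have "path (compacted_trie W) [] u u"
      using 1(1) l u(1) by simp
    moreover have "\<not> strict_prefix x w" if "x \<in> explicit_nodes W" "strict_prefix u x" for x
      using max[of x] that by (meson prefix_order.less_le_not_le)
    moreover from this have "(u, l, w) \<in> edges (compacted_trie W)"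
      using u l 1(2) by (auto simp: edges_compacted_trie_iff)
    ultimately show ?thesis
      using path.step l(1) by metis
  qed
qed

section \<open>Existence and uniqueness of the point with a given label\<close>

lemma path_label_Vertex_iff:
  "path_label (compacted_trie W) (Vertex v) w \<longleftrightarrow> v = w \<and> w \<in> explicit_nodes W"
proof -
  have "path_label (compacted_trie W) (Vertex v) w \<longleftrightarrow> path (compacted_trie W) [] w v"
    by (simp add: path_label.simps)
  then show ?thesis
    using path_compacted_trieD path_compacted_trie_verts path_to_explicit_node
    by (metis append_Nil)
qed

lemma path_label_Mid_iff:
  "path_label (compacted_trie W) (Mid u l v k) w \<longleftrightarrow>
    (u, l, v) \<in> edges (compacted_trie W) \<and> 0 < k \<and> k < length l \<and> w = u @ take k l"
proof -
  have "path (compacted_trie W) [] u u" if "(u, l, v) \<in> edges (compacted_trie W)"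
    using that by (simp add: edges_compacted_trie_iff path_to_explicit_node)
  then show ?thesis
    by (auto simp: path_label.simps dest: path_compacted_trieD)
qed

lemma path_label_Mid_strict_prefix:
  assumes "path_label (compacted_trie W) (Mid u l v k) w"
  shows "strict_prefix u w" "strict_prefix w v"
  using assms by (auto simp: path_label_Mid_iff edges_compacted_trie_iff strict_prefix_def
      take_is_prefix)

text \<open>A non-explicit \<open>w\<close> lies on the edge from its longest explicit strict prefix
  to a shortest explicit word extending it.\<close>

lemma ex_path_label:
  assumes "finite W" "w \<in> trie W"
  shows "\<exists>p. path_label (compacted_trie W) p w"
proof (cases "w \<in> explicit_nodes W")
  case True
  then show ?thesis
    using path_label_Vertex_iff by blast
next
  case False
  obtain v0 where "v0 \<in> explicit_nodes W \<and> prefix w v0"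
    using ex_explicit_extension[OF assms] by blast
  then obtain v where v: "v \<in> explicit_nodes W" "prefix w v"
    and min: "\<And>x. x \<in> explicit_nodes W \<Longrightarrow> prefix w x \<Longrightarrow> length v \<le> length x"
    using ex_has_least_nat[of "\<lambda>v. v \<in> explicit_nodes W \<and> prefix w v" v0 length] by blast
  have "w \<noteq> []"
    using False assms(2) Nil_explicit by blast
  then obtain u where u: "u \<in> explicit_nodes W" "strict_prefix u w"
    and max: "\<And>x. x \<in> explicit_nodes W \<Longrightarrow> strict_prefix x w \<Longrightarrow> prefix x u"
    using ex_longest_explicit_prefix[OF assms(2)] by metis
  obtain y where y: "w = u @ y" "y \<noteq> []"
    using u(2) by (blast elim: strict_prefixE')
  obtain z where z: "v = w @ z" "z \<noteq> []"
    using v False by (cases "v = w") (auto simp: prefix_def)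
  \<comment> \<open>Both \<open>x\<close> and \<open>w\<close> are prefixes of \<open>v\<close>,
    hence comparable. If \<open>x\<close> extends \<open>w\<close>, it contradicts the choice of
    \<open>v\<close>; if it is a strict prefix of \<open>w\<close>, that of
    \<open>u\<close>.\<close>
  have "\<not> strict_prefix x v" if x: "x \<in> explicit_nodes W" "strict_prefix u x" for x
  proof
    assume xv: "strict_prefix x v"
    then have "\<not> prefix w x"
      using min[OF x(1)] prefix_length_less[of x v] by auto
    moreover have "prefix w x \<or> prefix x w"
      using xv v(2) prefix_same_cases[of w v x] by (auto simp: strict_prefix_def)
    ultimately have "strict_prefix x w"
      by (auto simp: strict_prefix_def)
    then show False
      using max[OF x(1)] x(2) by auto
  qed
  then have "(u, y @ z, v) \<in> edges (compacted_trie W)"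
    using u v y z by (auto simp: edges_compacted_trie_iff)
  then have "path_label (compacted_trie W) (Mid u (y @ z) v (length y)) w"
    using y z by (auto simp: path_label_Mid_iff)
  then show ?thesis ..
qed

lemma path_label_Mid_not_explicit:
  assumes "path_label (compacted_trie W) (Mid u l v k) w"
  shows "w \<notin> explicit_nodes W"
  using assms path_label_Mid_strict_prefix[OF assms]
  by (auto simp: path_label_Mid_iff edges_compacted_trie_iff)

text \<open>Being prefixes of \<open>w\<close>, the words \<open>u\<close> and \<open>x\<close> are
  comparable, and \<open>x\<close> cannot lie inside the edge. So \<open>w\<close> alone determines
  the upper end of its edge.\<close>

lemma path_label_Mid_upper:
  assumes "path_label (compacted_trie W) (Mid u l v k) w"
    and "x \<in> explicit_nodes W" "prefix x w"
  shows "prefix x u"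
proof -
  have uw: "strict_prefix u w" "strict_prefix w v"
    using path_label_Mid_strict_prefix[OF assms(1)] by blast+
  have "strict_prefix x v"
    using assms(3) uw(2) by (rule prefix_order.le_less_trans)
  then have "\<not> strict_prefix u x"
    using assms(1,2) by (auto simp: path_label_Mid_iff edges_compacted_trie_iff)
  moreover have "prefix u x \<or> prefix x u"
    using uw(1) assms(3) prefix_same_cases[of u w x] by (auto simp: strict_prefix_def)
  ultimately show ?thesis
    by (auto simp: strict_prefix_def)
qed

text \<open>Two lower ends that diverge would do so at a branching node below \<open>w\<close>.\<close>

lemma path_label_Mid_lower:
  assumes "path_label (compacted_trie W) (Mid u l v k) w"
    and "x \<in> explicit_nodes W" "prefix w x"
  shows "prefix v x"
proof -
  have uw: "strict_prefix u w" "strict_prefix w v"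
    using path_label_Mid_strict_prefix[OF assms(1)] by blast+
  have gap: "\<not> strict_prefix y v" if "y \<in> explicit_nodes W" "prefix w y" for y
    using assms(1) that prefix_order.less_le_trans[OF uw(1) that(2)]
    by (auto simp: path_label_Mid_iff edges_compacted_trie_iff)
  have v: "v \<in> trie W"
    using assms(1) by (auto simp: path_label_Mid_iff edges_compacted_trie_iff explicit_nodes_trie)
  have "\<not> v \<parallel> x"
  proof
    assume "v \<parallel> x"
    then obtain ps b bs c cs where div: "b \<noteq> c" "v = ps @ b # bs" "x = ps @ c # cs"
      using parallel_decomp by metis
    have "ps @ [b] \<in> trie W" "ps @ [c] \<in> trie W" "ps \<in> trie W"
      using v explicit_nodes_trie[OF assms(2)] div trie_prefix_closed[of _ v W] 
        trie_prefix_closed[of _ x W] by (auto simp: prefix_def)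
    with div(1) have ps: "ps \<in> explicit_nodes W"
      by (auto simp: explicit_nodes_def trie_branching_def)
    \<comment> \<open>Otherwise \<open>w\<close> reaches past \<open>ps\<close>, and its letter
      there would be both \<open>b\<close> and \<open>c\<close>, since \<open>w\<close> is a prefix
      of \<open>v\<close> and of \<open>x\<close>.\<close>
    have "prefix w ps"
    proof (rule ccontr)
      assume "\<not> prefix w ps"
      then have "strict_prefix ps w"
        using prefix_same_cases[of w v ps] uw(2) div(2) by (auto simp: strict_prefix_def)
      then obtain e es where "w = ps @ e # es"
        by (rule strict_prefixE')
      then show False
        using uw(2) assms(3) div by (auto simp: strict_prefix_def)
    qed
    moreover have "strict_prefix ps v"
      using div(2) by (simp add: strict_prefix_def)
    ultimately show False
      using gap ps by blast
  qed
  moreover have "\<not> strict_prefix x v"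
    using gap assms(2,3) by blast
  ultimately show ?thesis
    by (auto simp: strict_prefix_def)
qed

lemma path_label_unique:
  assumes "path_label (compacted_trie W) p w" "path_label (compacted_trie W) q w"
  shows "p = q"
proof -
  have "u = u' \<and> l = l' \<and> v = v' \<and> k = k'"
    if p: "path_label (compacted_trie W) (Mid u l v k) w"
      and q: "path_label (compacted_trie W) (Mid u' l' v' k') w" for u l v k u' l' v' k'
  proof -
    note pq = path_label_Mid_strict_prefix[OF p] path_label_Mid_strict_prefix[OF q]
    have E: "{u, u', v, v'} \<subseteq> explicit_nodes W"
      using p q by (auto simp: path_label_Mid_iff edges_compacted_trie_iff)
    \<comment> \<open>Each upper end is a prefix of the other; the lower ends are treated alike. The
      ends then fix the label, and the length of \<open>w\<close> fixes the offset.\<close>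
    have "u = u'"
      using path_label_Mid_upper[OF p, of u'] path_label_Mid_upper[OF q, of u] E pq
      by (auto simp: strict_prefix_def)
    moreover have "v = v'"
      using path_label_Mid_lower[OF p, of v'] path_label_Mid_lower[OF q, of v] E pq
      by (auto simp: strict_prefix_def)
    ultimately have "l = l'"
      using p q by (auto simp: path_label_Mid_iff edges_compacted_trie_iff)
    moreover have "length u + k = length w"
      using p by (auto simp: path_label_Mid_iff)
    moreover have "length u' + k' = length w"
      using q by (auto simp: path_label_Mid_iff)
    ultimately show ?thesis
      using \<open>u = u'\<close> \<open>v = v'\<close> by simp
  qed
  with assms show ?thesis
    by (cases p; cases q) (auto simp: path_label_Vertex_iff dest: path_label_Mid_not_explicit)
qed

lemma path_label_locus:
  assumes "finite W" "w \<in> trie W"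
  shows "path_label (compacted_trie W) (locus (compacted_trie W) w) w"
  unfolding locus_def
  using ex_path_label[OF assms] path_label_unique by (metis theI)

text \<open>The label of a vertex extends that of each vertex above it. In the middle of an edge,
  the paths counted by \<open>below\<close> start at the lower end, whose label already extends
  \<open>w\<close>.\<close>

lemma below_locus_prefix:
  assumes "finite W" "w \<in> trie W"
    and "below (compacted_trie W) v (locus (compacted_trie W) w)"
  shows "prefix w v"
proof (cases "locus (compacted_trie W) w")
  case (Vertex u)
  then have "u = w"
    using path_label_locus[OF assms(1,2)] by (simp add: path_label_Vertex_iff)
  with Vertex assms(3) show ?thesis
    by (auto dest: path_compacted_trieD)
next
  case (Mid u l x k)
  then have "strict_prefix w x"
    using path_label_locus[OF assms(1,2)] path_label_Mid_strict_prefix by metis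
  moreover have "prefix x v"
    using Mid assms(3) by (auto dest: path_compacted_trieD)
  ultimately show ?thesis
    by (auto simp: strict_prefix_def)
qed

subsection \<open>Periods\<close>

lemma prefix_drop_mono: "prefix u w \<Longrightarrow> prefix (drop n u) (drop n w)"
  by (auto simp: prefix_def)

text \<open>The assumption says that \<open>p\<close> is a period of \<open>w\<close>. Dropping
  \<open>p\<close> more letters on both sides advances the induction; past the end of
  \<open>w\<close> the dropped word is empty.\<close>

lemma prefix_drop_mult_period:
  assumes "prefix (drop p w) w"
  shows "prefix (drop (n * p) w) w"
proof (induction n)
  case (Suc n)
  have "prefix (drop p (drop (n * p) w)) (drop p w)"
    using Suc by (rule prefix_drop_mono)
  with assms show ?case
    by (metis drop_drop mult_Suc prefix_order.trans)
qed simp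

lemma rho_eq:
  assumes "L < a" "a \<le> i"
  shows "rho a L i = L + (i - a) mod (a - L)"
proof -
  have "(int i - int a) mod (int a - int L) = int ((i - a) mod (a - L))"
    using assms by (simp add: of_nat_diff zmod_int)
  then show ?thesis
    by (simp add: rho_def flip: of_nat_add)
qed

lemma suffix_at_in_trie: "suffix_at S i \<in> trie (set (suffixes S))"
  by (auto simp: trie_def suffix_at_def suffix_drop)

theorem lemma2:
  fixes S :: "'a list" and a L :: nat and v :: "'a list"
  assumes "\<exists>i. implicit_suffix S i \<and> suffix_at S i \<noteq> []"
    and "longest_implicit_suffix S a"
    and "leaf_position S v L"
    and "below (suffix_tree S) v (locus (suffix_tree S) (suffix_at S a))"
  shows "\<forall>i. implicit_suffix S i \<longrightarrow> prefix (suffix_at S i) (suffix_at S (rho a L i))"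
proof (intro allI impI)
  fix i
  assume i: "implicit_suffix S i"
  have v: "v = suffix_at S L"
    using assms(3) by (simp add: leaf_position_def suffix_tree_def path_label_Vertex_iff)
  have pre: "prefix (suffix_at S a) (suffix_at S L)"
    using assms(4) below_locus_prefix[OF _ suffix_at_in_trie] 
    by (simp add: suffix_tree_def flip: v)
  have pos: "a \<in> positions S" "L \<in> positions S" "i \<in> positions S"
    using assms(2,3) i
    by (auto simp: longest_implicit_suffix_def implicit_suffix_def leaf_position_def)
  have "L \<noteq> a"
    using assms(2,3)
    by (auto simp: longest_implicit_suffix_def implicit_suffix_def leaf_represented_def)
  \<comment> \<open>For a position \<open>i\<close> from 1 to d + 1 the suffix has length d + 1 - i,
    so comparing lengths compares positions, also for the empty suffix.\<close>
  moreover have "L \<le> a"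
    using prefix_length_le[OF pre] pos by (auto simp: suffix_at_def positions_def)
  ultimately have La: "L < a"
    by simp
  have "length (suffix_at S i) \<le> length (suffix_at S a)"
    using assms(2) i by (simp add: longest_implicit_suffix_def)
  then have ai: "a \<le> i"
    using pos by (auto simp: suffix_at_def positions_def)
  define p where "p = a - L"
  define r where "r = (i - a) mod p"
  define w where "w = suffix_at S L"
  \<comment> \<open>This relies on \<open>L\<close> being at least 1, as \<open>suffix_at\<close>
    subtracts 1.\<close>
  have at: "suffix_at S (L + n) = drop n w" for n
    using pos by (simp add: w_def suffix_at_def positions_def add.commute)
  \<comment> \<open>By \<open>at\<close>, the word \<open>drop p w\<close> is the suffix at
    \<open>a\<close>.\<close>
  have "prefix (drop p w) w"
    using pre La at[of p] by (simp add: w_def p_def)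
  then have "prefix (drop r (drop (Suc ((i - a) div p) * p) w)) (drop r w)"
    by (intro prefix_drop_mono prefix_drop_mult_period)
  \<comment> \<open>The extra period under \<open>Suc\<close> covers the distance from
    \<open>L\<close> to \<open>a\<close>; the quotient and \<open>r\<close> cover that from
    \<open>a\<close> to \<open>i\<close>.\<close>
  moreover have "r + Suc ((i - a) div p) * p = i - L"
    using La ai mod_div_mult_eq[of "i - a" p] unfolding r_def p_def mult_Suc by linarith
  ultimately have "prefix (suffix_at S (L + (i - L))) (suffix_at S (L + r))"
    by (simp only: at drop_drop add.commute)
  then show "prefix (suffix_at S i) (suffix_at S (rho a L i))"
    using La ai by (simp add: rho_eq r_def p_def)
qed

end
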